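(* Let $g(x)$, $x\in\mathbb{R}^2$, be a path loss function which depends only on $\|x\|$, decreases monotonically with $\|x\|$, and satisfies $\int_0^\infty r\,g(r)\,\mathrm{d}r<\infty$ (writing $g(r)$ for the value of $g$ at points with $\|x\|=r$). Let $I_k(z)$ denote the interference at time $k$ and location $z\in\mathbb{R}^2$ in the Poisson network with ALOHA transmit probability $p$ described in the context. Then the spatio-temporal correlation coefficient of the interferences $I_k(u)$ and $I_l(v)$, $k\neq l$, $u,v\in\mathbb{R}^2$, is given by $$\zeta(u,v)=\frac{p\int_{\mathbb{R}^2} g(x)\,g(x-w)\,\mathrm{d}x}{\mathbb{E}[h^2]\int_{\mathbb{R}^2} g^2(x)\,\mathrm{d}x},$$ where $w\in\mathbb{R}^2$ is any vector with $\|w\|=\|u-v\|$ (since $g$ is radial, the value does not depend on the choice of $w$).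
   Context: Nodes form a homogeneous Poisson point process $\phi\subset\mathbb{R}^2$ of density $\lambda$. Time is slotted. The MAC protocol is ALOHA: in each slot every node of $\phi$ decides independently to transmit with probability $p$; $\phi_k\subset\phi$ is the set of nodes transmitting in slot $k$. All nodes transmit with unit power. The power fading coefficient between $x$ and $z$ in slot $k$ is $h_{xz}(k)$; the fading is spatially and temporally independent with unit mean, and $h$ denotes a generic fading coefficient, so $\mathbb{E}[h]=1$. The fading is independent of $\phi$ and of the ALOHA decisions. The interference at location $z$ in slot $k$ is $$I_k(z)=\sum_{x\in\phi}\mathbf{1}(x\in\phi_k)\,h_{xz}(k)\,g(x-z).$$ The correlation coefficient is the covariance of $I_k(u)$ and $I_l(v)$ divided by their common variance (the interferences are identically distributed), i.e. $\zeta(u,v)=\dfrac{\mathbb{E}[I_k(u)I_l(v)]-\mathbb{E}[I_k(u)]^2}{\mathbb{E}[I_k(u)^2]-\mathbb{E}[I_k(u)]^2}$. *)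

theory Defs
  imports "HOL-Probability.Probability"
begin

(* Random subset \<Phi> of the plane that is a homogeneous Poisson point process.
   Finiteness has to be demanded separately, because card is 0 on infinite sets.
   The Poisson mass function is written out, because poisson_pmf is specified for positive
   rates only and B may be a null set. *)
definition poisson_point_process ::
    "'w measure \<Rightarrow> real \<Rightarrow> ('w \<Rightarrow> (real^2) set) \<Rightarrow> bool" where
  "poisson_point_process M dens \<Phi> \<longleftrightarrow>
     (\<forall>B. B \<in> sets borel \<longrightarrow> bounded B \<longrightarrow>
        (AE \<omega> in M. finite (\<Phi> \<omega> \<inter> B)) \<and>
        (\<lambda>\<omega>. card (\<Phi> \<omega> \<inter> B)) \<in> M \<rightarrow>\<^sub>M count_space UNIV \<and>
        (\<forall>n. measure M {\<omega> \<in> space M. card (\<Phi> \<omega> \<inter> B) = n}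
           = (dens * measure lborel B) ^ n / fact n * exp (- (dens * measure lborel B)))) \<and>
     (\<forall>B :: nat \<Rightarrow> (real^2) set.
        (\<forall>n. B n \<in> sets borel \<and> bounded (B n)) \<longrightarrow> disjoint_family B \<longrightarrow>
        prob_space.indep_vars M (\<lambda>_. count_space UNIV) (\<lambda>n \<omega>. card (\<Phi> \<omega> \<inter> B n)) UNIV)"

(* The nodes of \<Phi> are enumerated measurably as X 0, X 1, ... (almost surely there are
   infinitely many, since the density is positive), and the marks of a node are attached to
   its index: an i.i.d. family indexed by all points of the plane could not be evaluated
   measurably at the random points of \<Phi>.
   T i k says that node i transmits in slot k; h i z k is the fading coefficient in slot k
   between node i and location z; H is the law of the generic fading coefficient. *)
locale aloha_network = prob_space M
  for M :: "'w measure" +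
  fixes dens p :: real
    and H :: "real measure"
    and \<Phi> :: "'w \<Rightarrow> (real^2) set"
    and X :: "nat \<Rightarrow> 'w \<Rightarrow> real^2"
    and T :: "nat \<Rightarrow> nat \<Rightarrow> 'w \<Rightarrow> bool"
    and h :: "nat \<Rightarrow> real^2 \<Rightarrow> nat \<Rightarrow> 'w \<Rightarrow> real"
  assumes dens_pos: "dens > 0"
    and p_range: "0 \<le> p" "p \<le> 1"
    and poisson: "poisson_point_process M dens \<Phi>"
    and X_measurable: "\<And>i. X i \<in> borel_measurable M"
    and X_enumerates: "AE \<omega> in M. bij_betw (\<lambda>i. X i \<omega>) UNIV (\<Phi> \<omega>)"
    and T_distr: "\<And>i k. distr M (count_space UNIV) (T i k) = measure_pmf (bernoulli_pmf p)"
    and T_indep: "indep_vars (\<lambda>_. count_space UNIV) (\<lambda>(i, k). T i k) UNIV"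
    and h_distr: "\<And>i z k. distr M borel (h i z k) = H"
    and h_indep: "indep_vars (\<lambda>_. borel) (\<lambda>(i, z, k). h i z k) UNIV"
    and H_nonneg: "AE t in H. 0 \<le> t"
    and H_mean: "integrable H (\<lambda>t. t)" "(\<integral>t. t \<partial>H) = 1"
    and X_T_h_indep:
      "indep_sets ((!)
         [sets (vimage_algebra (space M) (\<lambda>\<omega> i. X i \<omega>) (PiM UNIV (\<lambda>_. borel))),
          sets (vimage_algebra (space M) (\<lambda>\<omega> (i, k). T i k \<omega>) (PiM UNIV (\<lambda>_. count_space UNIV))),
          sets (vimage_algebra (space M) (\<lambda>\<omega> (i, z, k). h i z k \<omega>) (PiM UNIV (\<lambda>_. borel)))])
         {..<3}"

(* Values in [0,\<infinity>], so that path loss functions with a pole at the origin are covered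
   and the sum needs no convergence proof. *)
definition interference ::
    "(nat \<Rightarrow> 'w \<Rightarrow> real^2) \<Rightarrow> (nat \<Rightarrow> nat \<Rightarrow> 'w \<Rightarrow> bool) \<Rightarrow>
     (nat \<Rightarrow> real^2 \<Rightarrow> nat \<Rightarrow> 'w \<Rightarrow> real) \<Rightarrow> (real^2 \<Rightarrow> ennreal) \<Rightarrow>
     nat \<Rightarrow> real^2 \<Rightarrow> 'w \<Rightarrow> ennreal" where
  "interference X T h g k z \<omega> =
     (\<Sum>i. of_bool (T i k \<omega>) * ennreal (h i z k \<omega>) * g (X i \<omega> - z))"

(* Expectation of a [0,\<infinity>]-valued variable; the type ereal is used because subtraction
   on ennreal truncates at 0. *)
definition expect :: "'w measure \<Rightarrow> ('w \<Rightarrow> ennreal) \<Rightarrow> ereal" where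
  "expect M Y = enn2ereal (\<integral>\<^sup>+\<omega>. Y \<omega> \<partial>M)"

(* For identically distributed Y and Z. Infinite variance gives 0, by a / \<infinity> = 0 in ereal. *)
definition correlation_coefficient ::
    "'w measure \<Rightarrow> ('w \<Rightarrow> ennreal) \<Rightarrow> ('w \<Rightarrow> ennreal) \<Rightarrow> ereal" where
  "correlation_coefficient M Y Z =
     (expect M (\<lambda>\<omega>. Y \<omega> * Z \<omega>) - (expect M Y)\<^sup>2) /
     (expect M (\<lambda>\<omega>. (Y \<omega>)\<^sup>2) - (expect M Y)\<^sup>2)"

end

theory Submission
  imports Defs
begin

text \<open>
  Expand the product of the two interferences into a double sum over pairs of nodes. Off the
  diagonal, both ALOHA decisions and fadings are independent, and the second factorial moment
  measure of the Poisson process is the product of its intensity with itself; this part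
  is the squared mean, so it cancels in every covariance. On the diagonal, Campbell's formula
  leaves the density times the integral of \<open>g (x - u) * g (x - v)\<close>, with weight \<open>p\<^sup>2\<close> for distinct
  slots and \<open>p\<close> times the second moment of the fading for the variance. Rotation invariance
  of Lebesgue measure replaces \<open>v - u\<close> by \<open>w\<close>. Integrability of \<open>r * G r\<close> makes the mean finite,
  which is what the cancellation needs; all other degenerate cases agree by the conventions of
  \<open>ereal\<close> division.
\<close>

section \<open>Radial functions and Lebesgue measure\<close>

lemma borel_measurable_orthogonal_transformation:
  fixes f :: "'a::euclidean_space \<Rightarrow> 'a"
  assumes "orthogonal_transformation f"
  shows "f \<in> borel_measurable borel"
proof (rule borel_measurable_continuous_onI)
  have "linear f"
    using assms by (rule orthogonal_transformation_linear)
  then show "continuous_on UNIV f"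
    by (simp add: linear_continuous_on linear_conv_bounded_linear)
qed

text \<open>A Borel measure with the right values on boxes is \<open>lborel\<close>, and orthogonal
  maps preserve volume. The volume facts concern images, so the preimage of a box is read as its
  image under the inverse, which is orthogonal as well.\<close>

lemma distr_lborel_orthogonal_transformation:
  fixes f :: "real^'n::{finite,wellorder} \<Rightarrow> real^'n::_"
  assumes f: "orthogonal_transformation f"
  shows "distr lborel borel f = lborel"
proof (rule lborel_eqI[symmetric])
  have f_borel [measurable]: "f \<in> borel_measurable borel"
    using f by (rule borel_measurable_orthogonal_transformation)
  fix l u :: "real^'n::{finite,wellorder}"
  assume le: "\<And>b. b \<in> Basis \<Longrightarrow> l \<bullet> b \<le> u \<bullet> b"
  have "f -` box l u = inv f ` box l u"
    using orthogonal_transformation_bij[OF f] by (rule bij_vimage_eq_inv_image)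
  moreover have "inv f ` box l u \<in> lmeasurable"
    "measure lebesgue (inv f ` box l u) = measure lebesgue (box l u)"
    by (intro measurable_orthogonal_image measure_orthogonal_image
        orthogonal_transformation_inv[OF f] lmeasurable_box)+
  ultimately have "emeasure lebesgue (f -` box l u) = emeasure lebesgue (box l u)"
    by (simp add: emeasure_eq_measure2)
  \<comment> \<open>The comparison so far is in \<open>lebesgue\<close>; on Borel sets it transfers
    to \<open>lborel\<close>.\<close>
  moreover have "f -` box l u \<in> sets borel"
    using measurable_sets[OF f_borel, of "box l u"] by simp
  ultimately have "emeasure lborel (f -` box l u) = emeasure lborel (box l u)"
    by simp
  then show "emeasure (distr lborel borel f) (box l u) = (\<Prod>b\<in>Basis. (u - l) \<bullet> b)"
    using le by (simp add: emeasure_distr emeasure_lborel_box)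
qed simp

lemma nn_integral_lborel_translation:
  fixes f :: "'a::euclidean_space \<Rightarrow> ennreal"
  assumes [measurable]: "f \<in> borel_measurable borel"
  shows "(\<integral>\<^sup>+x. f (x - a) \<partial>lborel) = (\<integral>\<^sup>+x. f x \<partial>lborel)"
proof -
  have "(\<integral>\<^sup>+x. f x \<partial>lborel) = (\<integral>\<^sup>+x. f x \<partial>distr lborel borel (\<lambda>x. - a + x))"
    using lborel_affine[of 1 "- a"] by (simp add: density_1)
  then show ?thesis
    by (simp add: nn_integral_distr)
qed

text \<open>Translation by \<open>u\<close> leaves only the difference \<open>v - u\<close>.
  Equality of norms provides an orthogonal \<open>f\<close> that moves it to \<open>w\<close>;
  \<open>f\<close> preserves Lebesgue measure and, by radiality, the values of
  \<open>g\<close>.\<close>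

lemma nn_integral_radial_convolution_cong:
  fixes g :: "real^'n::{finite,wellorder} \<Rightarrow> ennreal"
  assumes [measurable]: "g \<in> borel_measurable borel"
    and radial: "\<And>x y. norm x = norm y \<Longrightarrow> g x = g y"
    and w: "norm w = norm (u - v)"
  shows "(\<integral>\<^sup>+x. g (x - u) * g (x - v) \<partial>lborel) = (\<integral>\<^sup>+x. g x * g (x - w) \<partial>lborel)"
proof -
  obtain f where f: "orthogonal_transformation f" "f (v - u) = w"
    using orthogonal_transformation_exists[of "v - u" w] w norm_minus_commute[of u v] by auto
  have f_borel [measurable]: "f \<in> borel_measurable borel"
    using f(1) by (rule borel_measurable_orthogonal_transformation)
  have "(\<integral>\<^sup>+x. g (x - u) * g (x - v) \<partial>lborel) = (\<integral>\<^sup>+x. g x * g (x - (v - u)) \<partial>lborel)"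
    using nn_integral_lborel_translation[of "\<lambda>x. g x * g (x - (v - u))" u] by simp
  also have "\<dots> = (\<integral>\<^sup>+x. g (f x) * g (f x - w) \<partial>lborel)"
  proof (rule nn_integral_cong)
    fix x
    have "f x - w = f (x - (v - u))"
      using f by (simp add: linear_diff orthogonal_transformation_linear)
    then have "g (f x - w) = g (x - (v - u))"
      by (simp only: radial[OF orthogonal_transformation_norm[OF f(1)]])
    moreover have "g (f x) = g x"
      by (rule radial[OF orthogonal_transformation_norm[OF f(1)]])
    ultimately show "g x * g (x - (v - u)) = g (f x) * g (f x - w)"
      by simp
  qed
  also have "\<dots> = (\<integral>\<^sup>+x. g x * g (x - w) \<partial>distr lborel borel f)"
    by (simp add: nn_integral_distr)
  finally show ?thesis
    by (simp add: distr_lborel_orthogonal_transformation[OF f(1)])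
qed

text \<open>The superlevel sets of a monotone function are intervals.\<close>

lemma borel_measurable_antimono_ennreal:
  fixes f :: "real \<Rightarrow> ennreal"
  assumes "antimono f"
  shows "f \<in> borel_measurable borel"
proof (rule borel_measurableI_greater)
  fix y
  have "is_interval {x. y < f x}"
    unfolding is_interval_1 using assms by (auto dest: antimonoD intro: less_le_trans)
  then show "{x \<in> space borel. y < f x} \<in> sets borel"
    by (simp add: real_interval_borel_measurable)
qed

text \<open>Both sides give \<open>{..a}\<close>, that is the disc of radius \<open>a\<close>, the mass \<open>pi * a\<^sup>2\<close>.\<close>
lemma distr_lborel_norm_plane:
  "distr lborel borel (norm :: real^2 \<Rightarrow> real) =
     density lborel (\<lambda>r. ennreal (2 * pi * r) * indicator {0..} r)"
proof (rule measure_eqI_generator_eq)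
  let ?E = "range (\<lambda>a::real. {..a})"
  show "Int_stable ?E"
    by (auto simp: Int_stable_def)
  show "?E \<subseteq> Pow UNIV" by simp
  have borel: "sets (borel :: real measure) = sigma_sets UNIV ?E"
    unfolding borel_eq_atMost by (rule sets_measure_of) simp
  show "sets (distr lborel borel (norm :: real^2 \<Rightarrow> real)) = sigma_sets UNIV ?E"
    "sets (density lborel (\<lambda>r. ennreal (2 * pi * r) * indicator {0..} r)) = sigma_sets UNIV ?E"
    using borel by simp_all
  have disc: "emeasure (distr lborel borel (norm :: real^2 \<Rightarrow> real)) {..a} =
      (if a < 0 then 0 else ennreal (pi * a\<^sup>2))" for a
  proof -
    have "norm -` {..a} = cball (0 :: real^2) a" by auto
    then show ?thesis
      by (simp add: emeasure_distr emeasure_cball unit_ball_vol_2)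
  qed
  show "range (\<lambda>n. {..real n}) \<subseteq> ?E" by auto
  show "(\<Union>n. {..real n}) = UNIV"
    by (simp add: set_eq_iff real_arch_simple)
  show "emeasure (distr lborel borel (norm :: real^2 \<Rightarrow> real)) {..real n} \<noteq> \<infinity>" for n
    by (simp add: disc)
  fix S :: "real set" assume "S \<in> ?E"
  then obtain a where S: "S = {..a}" by auto
  have "emeasure (density lborel (\<lambda>r. ennreal (2 * pi * r) * indicator {0..} r)) {..a} =
      (\<integral>\<^sup>+r. ennreal (2 * pi * r) * indicator {0..a} r \<partial>lborel)"
    by (subst emeasure_density) (auto intro!: nn_integral_cong split: split_indicator)
  also have "\<dots> = (if a < 0 then 0 else ennreal (pi * a\<^sup>2))"
  proof (cases "a < 0")
    case False
    then have "(\<integral>\<^sup>+r. ennreal (2 * pi * r) * indicator {0..a} r \<partial>lborel) = pi * a\<^sup>2 - pi * 0\<^sup>2"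
      by (intro nn_integral_FTC_Icc) (auto intro!: derivative_eq_intros)
    then show ?thesis using False by simp
  qed simp
  finally show "emeasure (distr lborel borel (norm :: real^2 \<Rightarrow> real)) S =
      emeasure (density lborel (\<lambda>r. ennreal (2 * pi * r) * indicator {0..} r)) S"
    by (simp add: S disc)
qed

text \<open>Integration in polar coordinates: under \<open>lborel\<close>, \<open>norm\<close> has
  density \<open>2 * pi * r\<close> on the half-line. Measurability of \<open>g\<close> comes from
  monotonicity.\<close>

lemma
  fixes g :: "real^2 \<Rightarrow> ennreal" and G :: "real \<Rightarrow> ennreal"
  assumes radial: "\<And>x. g x = G (norm x)"
    and decreasing: "\<And>r s. 0 \<le> r \<Longrightarrow> r \<le> s \<Longrightarrow> G s \<le> G r"
  shows borel_measurable_radial_decreasing: "g \<in> borel_measurable borel"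
    and nn_integral_radial_decreasing:
      "(\<integral>\<^sup>+x. g x \<partial>lborel) = ennreal (2 * pi) * (\<integral>\<^sup>+r\<in>{0..}. ennreal r * G r \<partial>lborel)"
proof -
  \<comment> \<open>\<open>decreasing\<close> speaks of nonnegative radii only. Continuing
    \<open>G\<close> to the left by the constant \<open>G 0\<close> gives a function that is
    antitone on the whole line, hence Borel, and leaves \<open>g\<close> unchanged.\<close>
  define G' where "G' = (\<lambda>r. G (max 0 r))"
  have [measurable]: "G' \<in> borel_measurable borel"
    by (rule borel_measurable_antimono_ennreal) (auto simp: G'_def intro!: antimonoI decreasing)
  have g: "g = (\<lambda>x. G' (norm x))"
    by (simp add: fun_eq_iff radial G'_def)
  show "g \<in> borel_measurable borel"
    unfolding g by measurable
  have "(\<integral>\<^sup>+x. g x \<partial>lborel) = (\<integral>\<^sup>+r. G' r \<partial>distr lborel borel (norm :: real^2 \<Rightarrow> real))"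
    by (simp add: g nn_integral_distr)
  also have "\<dots> = (\<integral>\<^sup>+r. ennreal (2 * pi) * (ennreal r * G' r * indicator {0..} r) \<partial>lborel)"
    unfolding distr_lborel_norm_plane
    by (subst nn_integral_density)
      (auto intro!: nn_integral_cong simp: ennreal_mult ac_simps split: split_indicator)
  also have "\<dots> = ennreal (2 * pi) * (\<integral>\<^sup>+r. ennreal r * G' r * indicator {0..} r \<partial>lborel)"
    by (rule nn_integral_cmult) measurable
  also have "(\<integral>\<^sup>+r. ennreal r * G' r * indicator {0..} r \<partial>lborel) =
      (\<integral>\<^sup>+r\<in>{0..}. ennreal r * G r \<partial>lborel)"
    by (auto intro!: nn_integral_cong simp: G'_def split: split_indicator)
  finally show "(\<integral>\<^sup>+x. g x \<partial>lborel) = ennreal (2 * pi) * (\<integral>\<^sup>+r\<in>{0..}. ennreal r * G r \<partial>lborel)" .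
qed

section \<open>Poisson sums and products of series\<close>

text \<open>Mean and second moment of the Poisson law; \<open>a = 0\<close> is included, which
  covers null sets. The identity \<open>shift\<close> absorbs one factor \<open>n\<close> into the
  index: the mean reduces to the total mass, the second moment to \<open>a\<close> times the sum of
  mean and total mass.\<close>

lemma sums_poisson:
  fixes a :: real
  shows "(\<lambda>n. real n * (a ^ n / fact n * exp (- a))) sums a"
    and "(\<lambda>n. real n * real n * (a ^ n / fact n * exp (- a))) sums (a\<^sup>2 + a)"
proof -
  let ?c = "\<lambda>n. a ^ n / fact n * exp (- a)"
  have c: "?c sums 1"
    using sums_mult2[OF exp_converges[of a], of "exp (- a)"]
    by (simp add: divide_inverse exp_minus ac_simps)
  have shift: "real (Suc n) * ?c (Suc n) = a * ?c n" for n
  proof -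
    have "fact (Suc n) = real (Suc n) * fact n"
      by simp
    then show ?thesis
      by (simp only: power_Suc) (simp add: field_simps del: of_nat_Suc fact_Suc)
  qed
  have "(\<lambda>n. real (Suc n) * ?c (Suc n)) sums a"
    unfolding shift using sums_mult[OF c, of a] by simp
  then show first: "(\<lambda>n. real n * ?c n) sums a"
    using sums_Suc[of "\<lambda>n. real n * ?c n" a] by simp
  have "(\<lambda>n. a * (real n * ?c n) + a * ?c n) sums (a * a + a * 1)"
    by (intro sums_add sums_mult first c)
  moreover have "a * (real n * ?c n) + a * ?c n = real (Suc n) * real (Suc n) * ?c (Suc n)" for n
  proof -
    have "real (Suc n) * (a * x) = a * (real n * x) + a * x" for x
      by (simp add: algebra_simps)
    then show ?thesis
      by (simp only: mult.assoc shift)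
  qed
  ultimately have "(\<lambda>n. real (Suc n) * real (Suc n) * ?c (Suc n)) sums (a\<^sup>2 + a)"
    by (simp only: power2_eq_square mult_1_right)
  then show "(\<lambda>n. real n * real n * ?c n) sums (a\<^sup>2 + a)"
    using sums_Suc[of "\<lambda>n. real n * real n * ?c n" "a\<^sup>2 + a"] by simp
qed

text \<open>The integral is split according to the value of \<open>N\<close>. Real sums and
  \<open>measure\<close> match the form in which the Poisson law is given.\<close>

lemma (in finite_measure) nn_integral_nat_valued:
  fixes N :: "'a \<Rightarrow> nat" and f :: "nat \<Rightarrow> real"
  assumes N [measurable]: "N \<in> M \<rightarrow>\<^sub>M count_space UNIV"
    and f: "\<And>n. 0 \<le> f n"
    and sums: "(\<lambda>n. f n * measure M {\<omega> \<in> space M. N \<omega> = n}) sums s"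
  shows "(\<integral>\<^sup>+\<omega>. ennreal (f (N \<omega>)) \<partial>M) = ennreal s"
proof -
  have "(\<integral>\<^sup>+\<omega>. ennreal (f (N \<omega>)) \<partial>M) =
      (\<integral>\<^sup>+\<omega>. \<integral>\<^sup>+n. ennreal (f n) * indicator {\<omega> \<in> space M. N \<omega> = n} \<omega> \<partial>count_space UNIV \<partial>M)"
  proof (rule nn_integral_cong)
    fix \<omega> assume "\<omega> \<in> space M"
    then have "(\<integral>\<^sup>+n. ennreal (f n) * indicator {\<omega> \<in> space M. N \<omega> = n} \<omega> \<partial>count_space UNIV) =
        (\<integral>\<^sup>+n. ennreal (f n) * indicator {N \<omega>} n \<partial>count_space UNIV)"
      by (intro nn_integral_cong) (auto split: split_indicator)
    then show "ennreal (f (N \<omega>)) =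
        (\<integral>\<^sup>+n. ennreal (f n) * indicator {\<omega> \<in> space M. N \<omega> = n} \<omega> \<partial>count_space UNIV)"
      by (simp add: nn_integral_indicator_singleton)
  qed
  also have "\<dots> = (\<Sum>n. \<integral>\<^sup>+\<omega>. ennreal (f n) * indicator {\<omega> \<in> space M. N \<omega> = n} \<omega> \<partial>M)"
    by (simp add: nn_integral_count_space_nat nn_integral_suminf)
  also have "\<dots> = (\<Sum>n. ennreal (f n * measure M {\<omega> \<in> space M. N \<omega> = n}))"
    by (simp add: nn_integral_cmult_indicator emeasure_eq_measure ennreal_mult f)
  also have "\<dots> = ennreal s"
    by (intro suminf_ennreal_eq mult_nonneg_nonneg f measure_nonneg sums)
  finally show ?thesis .
qed

text \<open>Series in \<open>ennreal\<close> can be rearranged freely. The off-diagonal part is an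
  integral over a counting measure so that it can later be exchanged with the expectation.\<close>

lemma suminf_mult_suminf_split_diagonal:
  fixes a b :: "nat \<Rightarrow> ennreal"
  shows "(\<Sum>i. a i) * (\<Sum>j. b j) =
    (\<integral>\<^sup>+(i, j). a i * b j \<partial>count_space {(i, j). i \<noteq> j}) + (\<Sum>i. a i * b i)"
proof -
  let ?f = "\<lambda>(i, j). a i * b j"
  let ?D = "{(i, j). i \<noteq> j} :: (nat \<times> nat) set"
  have "(\<Sum>i. a i) * (\<Sum>j. b j) = (\<Sum>i. a i * (\<Sum>j. b j))"
    by (rule ennreal_suminf_multc[symmetric])
  also have "\<dots> = (\<Sum>i. \<Sum>j. a i * b j)"
    by (simp only: ennreal_suminf_cmult)
  also have "\<dots> = (\<integral>\<^sup>+p. ?f p \<partial>count_space UNIV)"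
    using nn_integral_fst_count_space[of ?f] by (simp add: nn_integral_count_space_nat)
  also have "\<dots> = (\<integral>\<^sup>+p. ?f p * indicator ?D p + ?f p * indicator (- ?D) p \<partial>count_space UNIV)"
    by (intro nn_integral_cong) (auto split: split_indicator)
  also have "\<dots> = (\<integral>\<^sup>+p. ?f p \<partial>count_space ?D) + (\<integral>\<^sup>+p. ?f p \<partial>count_space (- ?D))"
    by (simp add: nn_integral_add nn_integral_count_space_indicator)
  also have "(\<integral>\<^sup>+p. ?f p \<partial>count_space (- ?D)) = (\<integral>\<^sup>+i. ?f (i, i) \<partial>count_space UNIV)"
    by (rule nn_integral_bij_count_space[symmetric]) (auto simp: bij_betw_def inj_on_def)
  finally show ?thesis
    by (simp add: nn_integral_count_space_nat)
qed

lemma nn_integral_suminf_mult_suminf: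
  fixes a b :: "nat \<Rightarrow> 'a \<Rightarrow> ennreal"
  assumes [measurable]: "\<And>i. a i \<in> borel_measurable M" "\<And>i. b i \<in> borel_measurable M"
  shows "(\<integral>\<^sup>+\<omega>. (\<Sum>i. a i \<omega>) * (\<Sum>j. b j \<omega>) \<partial>M) =
    (\<integral>\<^sup>+(i, j). (\<integral>\<^sup>+\<omega>. a i \<omega> * b j \<omega> \<partial>M) \<partial>count_space {(i, j). i \<noteq> j}) +
    (\<Sum>i. \<integral>\<^sup>+\<omega>. a i \<omega> * b i \<omega> \<partial>M)"
proof -
  let ?D = "{(i, j). i \<noteq> j} :: (nat \<times> nat) set"
  let ?f = "\<lambda>p \<omega>. a (fst p) \<omega> * b (snd p) \<omega>"
  interpret D: sigma_finite_measure "count_space ?D"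
    by (rule sigma_finite_measure_count_space_countable) simp
  \<comment> \<open>Joint measurability in outcome and index pair, from countability of the set of
    pairs.\<close>
  have "(\<lambda>z. ?f (snd z) (fst z)) \<in> borel_measurable (M \<Otimes>\<^sub>M count_space ?D)"
    by (rule measurable_compose_countable'[where I = ?D and g = snd and f = "\<lambda>p z. ?f p (fst z)"]) auto
  then have off_diagonal: "(\<lambda>\<omega>. \<integral>\<^sup>+p. ?f p \<omega> \<partial>count_space ?D) \<in> borel_measurable M"
    by (intro D.borel_measurable_nn_integral) (simp add: case_prod_unfold)
  have "(\<integral>\<^sup>+\<omega>. (\<Sum>i. a i \<omega>) * (\<Sum>j. b j \<omega>) \<partial>M) =
      (\<integral>\<^sup>+\<omega>. (\<integral>\<^sup>+p. ?f p \<omega> \<partial>count_space ?D) + (\<Sum>i. a i \<omega> * b i \<omega>) \<partial>M)"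
    by (simp add: suminf_mult_suminf_split_diagonal case_prod_unfold)
  also have "\<dots> = (\<integral>\<^sup>+\<omega>. (\<integral>\<^sup>+p. ?f p \<omega> \<partial>count_space ?D) \<partial>M) + (\<integral>\<^sup>+\<omega>. (\<Sum>i. a i \<omega> * b i \<omega>) \<partial>M)"
    by (intro nn_integral_add off_diagonal borel_measurable_suminf_order borel_measurable_times_ennreal assms)
  also have "(\<integral>\<^sup>+\<omega>. (\<integral>\<^sup>+p. ?f p \<omega> \<partial>count_space ?D) \<partial>M) =
      (\<integral>\<^sup>+p. (\<integral>\<^sup>+\<omega>. ?f p \<omega> \<partial>M) \<partial>count_space ?D)"
    by (rule nn_integral_count_space_nn_integral) auto
  also have "(\<integral>\<^sup>+\<omega>. (\<Sum>i. a i \<omega> * b i \<omega>) \<partial>M) = (\<Sum>i. \<integral>\<^sup>+\<omega>. a i \<omega> * b i \<omega> \<partial>M)"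
    by (rule nn_integral_suminf) measurable
  finally show ?thesis
    by (simp add: case_prod_unfold)
qed

section \<open>Campbell's formulas\<close>

text \<open>Campbell's formulas concern positions only, so the ALOHA decisions and the fading are
  left out here.\<close>

locale enumerated_poisson_process = prob_space M
  for M :: "'w measure" +
  fixes dens :: real
    and \<Phi> :: "'w \<Rightarrow> (real^2) set"
    and X :: "nat \<Rightarrow> 'w \<Rightarrow> real^2"
  assumes dens_pos: "dens > 0"
    and poisson: "poisson_point_process M dens \<Phi>"
    and X_measurable: "\<And>i. X i \<in> borel_measurable M"
    and X_enumerates: "AE \<omega> in M. bij_betw (\<lambda>i. X i \<omega>) UNIV (\<Phi> \<omega>)"
begin

declare X_measurable [measurable]

abbreviation count :: "(real^2) set \<Rightarrow> 'w \<Rightarrow> nat" where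
  "count B \<omega> \<equiv> card (\<Phi> \<omega> \<inter> B)"

section \<open>First and second moments of Poisson counts on bounded sets\<close>

lemma
  assumes "B \<in> sets borel" "bounded B"
  shows AE_finite_count: "AE \<omega> in M. finite (\<Phi> \<omega> \<inter> B)"
    and measurable_count: "count B \<in> M \<rightarrow>\<^sub>M count_space UNIV"
    and prob_count: "prob {\<omega> \<in> space M. count B \<omega> = n} =
      (dens * measure lborel B) ^ n / fact n * exp (- (dens * measure lborel B))"
  using poisson assms unfolding poisson_point_process_def by blast+

lemma
  assumes B: "B \<in> sets borel" "bounded B"
  shows nn_integral_count:
      "(\<integral>\<^sup>+\<omega>. ennreal (real (count B \<omega>)) \<partial>M) = ennreal (dens * measure lborel B)"
    and nn_integral_count_square:
      "(\<integral>\<^sup>+\<omega>. ennreal (real (count B \<omega>)) * ennreal (real (count B \<omega>)) \<partial>M) =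
        ennreal ((dens * measure lborel B)\<^sup>2 + dens * measure lborel B)"
proof -
  show "(\<integral>\<^sup>+\<omega>. ennreal (real (count B \<omega>)) \<partial>M) = ennreal (dens * measure lborel B)"
    using measurable_count[OF B] sums_poisson(1)[of "dens * measure lborel B"]
    by (intro nn_integral_nat_valued) (simp_all add: prob_count[OF B])
  have "(\<integral>\<^sup>+\<omega>. ennreal (real (count B \<omega>) * real (count B \<omega>)) \<partial>M) =
      ennreal ((dens * measure lborel B)\<^sup>2 + dens * measure lborel B)"
    using measurable_count[OF B] sums_poisson(2)[of "dens * measure lborel B"]
    by (intro nn_integral_nat_valued[where f = "\<lambda>n. real n * real n"])
      (simp_all add: prob_count[OF B])
  then show "(\<integral>\<^sup>+\<omega>. ennreal (real (count B \<omega>)) * ennreal (real (count B \<omega>)) \<partial>M) =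
      ennreal ((dens * measure lborel B)\<^sup>2 + dens * measure lborel B)"
    by (simp add: ennreal_mult)
qed

lemma nn_integral_count_disjoint:
  assumes A: "A \<in> sets borel" "bounded A" and B: "B \<in> sets borel" "bounded B"
    and disjoint: "A \<inter> B = {}"
  shows "(\<integral>\<^sup>+\<omega>. ennreal (real (count A \<omega>)) * ennreal (real (count B \<omega>)) \<partial>M) =
    ennreal (dens * measure lborel A) * ennreal (dens * measure lborel B)"
proof -
  \<comment> \<open>Independence of counts is postulated for disjoint sequences, so the pair is
    padded with empty sets.\<close>
  define S :: "nat \<Rightarrow> (real^2) set" where "S = (\<lambda>n. if n = 0 then A else if n = 1 then B else {})"
  have "\<forall>n. S n \<in> sets borel \<and> bounded (S n)" "disjoint_family S"
    using A B disjoint by (auto simp: S_def disjoint_family_on_def)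
  then have "indep_vars (\<lambda>_. count_space UNIV) (\<lambda>n \<omega>. count (S n) \<omega>) UNIV"
    using poisson unfolding poisson_point_process_def by blast
  then have "indep_vars (\<lambda>_. borel) (\<lambda>n \<omega>. ennreal (real (count (S n) \<omega>))) UNIV"
    by (rule indep_vars_compose2) simp
  then have "indep_vars (\<lambda>_. borel) (\<lambda>n \<omega>. ennreal (real (count (S n) \<omega>))) {0, 1}"
    by (rule indep_vars_subset) simp
  then have "(\<integral>\<^sup>+\<omega>. (\<Prod>n\<in>{0, 1}. ennreal (real (count (S n) \<omega>))) \<partial>M) =
      (\<Prod>n\<in>{0, 1}. \<integral>\<^sup>+\<omega>. ennreal (real (count (S n) \<omega>)) \<partial>M)"
    by (intro indep_vars_nn_integral) auto
  then show ?thesis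
    by (simp add: S_def nn_integral_count A B)
qed

text \<open>Cutting along \<open>A - B\<close>, \<open>B - A\<close> and \<open>A \<inter> B\<close>
  expands the product of counts into four terms. Three are products over disjoint sets and factor;
  the square of the count of \<open>A \<inter> B\<close> has second moment
  \<open>z\<^sup>2 + z\<close>, and this \<open>z\<close> is the covariance.\<close>

lemma nn_integral_count_mult:
  assumes A: "A \<in> sets borel" "bounded A" and B: "B \<in> sets borel" "bounded B"
  shows "(\<integral>\<^sup>+\<omega>. ennreal (real (count A \<omega>)) * ennreal (real (count B \<omega>)) \<partial>M) =
    ennreal (dens * measure lborel A) * ennreal (dens * measure lborel B) +
    ennreal (dens * measure lborel (A \<inter> B))"
proof -
  let ?c = "\<lambda>S \<omega>. ennreal (real (count S \<omega>))"
  let ?m = "\<lambda>S. dens * measure lborel S"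
  define S1 S2 S3 where "S1 = A - B" and "S2 = B - A" and "S3 = A \<inter> B"
  have S: "S1 \<in> sets borel" "bounded S1" "S2 \<in> sets borel" "bounded S2"
      "S3 \<in> sets borel" "bounded S3"
    using A B by (auto simp: S1_def S2_def S3_def intro: bounded_diff)
  have disj: "S1 \<inter> S2 = {}" "S1 \<inter> S3 = {}" "S3 \<inter> S2 = {}"
    by (auto simp: S1_def S2_def S3_def)
  have AB: "A = S1 \<union> S3" "B = S3 \<union> S2"
    by (auto simp: S1_def S2_def S3_def)
  have [measurable]: "count S1 \<in> M \<rightarrow>\<^sub>M count_space UNIV" "count S2 \<in> M \<rightarrow>\<^sub>M count_space UNIV"
      "count S3 \<in> M \<rightarrow>\<^sub>M count_space UNIV"
    using S by (auto intro: measurable_count)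
  have emeasure_finite: "emeasure lborel S < \<infinity>" if "bounded S" for S :: "(real^2) set"
    using that by (rule emeasure_bounded_finite)
  have m: "?m A = ?m S1 + ?m S3" "?m B = ?m S3 + ?m S2"
    using S disj emeasure_finite by (simp_all add: AB measure_Union distrib_left less_top)
  have nonneg: "0 \<le> ?m S" for S
    using dens_pos by simp
  have expand: "ennreal x * ennreal z + (ennreal x * ennreal y + (ennreal (z\<^sup>2 + z) + ennreal z * ennreal y)) =
      ennreal (x + z) * ennreal (z + y) + ennreal z" if "0 \<le> x" "0 \<le> y" "0 \<le> z" for x y z :: real
    using that
    by (simp add: algebra_simps power2_eq_square del: ennreal_plus flip: ennreal_mult ennreal_plus)
  have "(\<integral>\<^sup>+\<omega>. ?c A \<omega> * ?c B \<omega> \<partial>M) =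
      (\<integral>\<^sup>+\<omega>. ?c S1 \<omega> * ?c S3 \<omega> + (?c S1 \<omega> * ?c S2 \<omega> + (?c S3 \<omega> * ?c S3 \<omega> + ?c S3 \<omega> * ?c S2 \<omega>)) \<partial>M)"
  \<comment> \<open>Additivity of \<open>card\<close> needs finite sets, and finiteness is known
    almost surely only.\<close>
  proof (rule nn_integral_cong_AE)
    show "AE \<omega> in M. ?c A \<omega> * ?c B \<omega> =
        ?c S1 \<omega> * ?c S3 \<omega> + (?c S1 \<omega> * ?c S2 \<omega> + (?c S3 \<omega> * ?c S3 \<omega> + ?c S3 \<omega> * ?c S2 \<omega>))"
      using AE_finite_count[OF S(1,2)] AE_finite_count[OF S(3,4)] AE_finite_count[OF S(5,6)]
    proof eventually_elim
      case (elim \<omega>)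
      have "count A \<omega> = count S1 \<omega> + count S3 \<omega>" "count B \<omega> = count S3 \<omega> + count S2 \<omega>"
        unfolding AB Int_Un_distrib using elim disj by (subst card_Un_disjoint; blast)+
      then show ?case
        by (simp add: algebra_simps)
    qed
  qed
  also have "\<dots> = ennreal (?m S1) * ennreal (?m S3) + (ennreal (?m S1) * ennreal (?m S2) +
      (ennreal ((?m S3)\<^sup>2 + ?m S3) + ennreal (?m S3) * ennreal (?m S2)))"
    by (simp add: nn_integral_add nn_integral_count_disjoint nn_integral_count_square S disj)
  also have "\<dots> = ennreal (?m A) * ennreal (?m B) + ennreal (?m S3)"
    unfolding m by (rule expand) (rule nonneg)+
  finally show ?thesis
    by (simp add: S3_def)
qed

text \<open>The bridge from the enumeration to the random set: almost surely every point of
  \<open>\<Phi> \<omega>\<close> has exactly one index.\<close>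

lemma AE_suminf_indicator:
  assumes B: "B \<in> sets borel" "bounded B"
  shows "AE \<omega> in M. (\<Sum>i. indicator B (X i \<omega>)) = ennreal (real (count B \<omega>))"
  using X_enumerates AE_finite_count[OF B]
proof eventually_elim
  case (elim \<omega>)
  have bij: "bij_betw (\<lambda>i. X i \<omega>) {i. X i \<omega> \<in> B} (\<Phi> \<omega> \<inter> B)"
    using elim(1) unfolding bij_betw_def inj_on_def by auto
  have fin: "finite {i. X i \<omega> \<in> B}"
    using bij elim(2) bij_betw_finite by blast
  have "(\<Sum>i. indicator B (X i \<omega>)) = (\<Sum>i\<in>{i. X i \<omega> \<in> B}. indicator B (X i \<omega>) :: ennreal)"
    by (rule suminf_finite[OF fin]) simp
  also have "\<dots> = of_nat (card {i. X i \<omega> \<in> B})"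
    by simp
  finally show ?case
    using bij_betw_same_card[OF bij] by (simp add: ennreal_of_nat_eq_real_of_nat)
qed

lemma ennreal_mean_count:
  fixes S :: "(real^2) set"
  assumes "bounded S"
  shows "ennreal (dens * measure lborel S) = ennreal dens * emeasure lborel S"
proof -
  have "emeasure lborel S \<noteq> \<infinity>"
    using emeasure_bounded_finite[OF assms] by simp
  then show ?thesis
    using dens_pos by (simp add: ennreal_mult emeasure_eq_ennreal_measure)
qed

text \<open>The expected number of points in \<open>B\<close>, computed through the indices and
  through the Poisson mean.\<close>

lemma intensity_bounded:
  assumes B: "B \<in> sets borel" "bounded B"
  shows "(\<Sum>i. \<integral>\<^sup>+\<omega>. indicator B (X i \<omega>) \<partial>M) = ennreal dens * emeasure lborel B"
proof -
  have [measurable]: "B \<in> sets borel" by (rule B)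
  have "(\<Sum>i. \<integral>\<^sup>+\<omega>. indicator B (X i \<omega>) \<partial>M) = (\<integral>\<^sup>+\<omega>. (\<Sum>i. indicator B (X i \<omega>)) \<partial>M)"
    by (rule nn_integral_suminf[symmetric]) measurable
  also have "\<dots> = (\<integral>\<^sup>+\<omega>. ennreal (real (count B \<omega>)) \<partial>M)"
    by (rule nn_integral_cong_AE[OF AE_suminf_indicator[OF B]])
  finally show ?thesis
    by (simp add: nn_integral_count B ennreal_mean_count)
qed

text \<open>The diagonal contributes the finite amount \<open>dens * measure lborel (A \<inter> B)\<close> to the mixed moment
  of the counts, so it can be cancelled.\<close>
lemma factorial_moment_bounded:
  assumes A: "A \<in> sets borel" "bounded A" and B: "B \<in> sets borel" "bounded B"
  shows "(\<integral>\<^sup>+(i, j). (\<integral>\<^sup>+\<omega>. indicator A (X i \<omega>) * indicator B (X j \<omega>) \<partial>M)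
      \<partial>count_space {(i, j). i \<noteq> j}) =
    (ennreal dens * emeasure lborel A) * (ennreal dens * emeasure lborel B)"
    (is "?off = _")
proof -
  have [measurable]: "A \<in> sets borel" "B \<in> sets borel" by fact+
  let ?diag = "ennreal (dens * measure lborel (A \<inter> B))"
  have AB: "A \<inter> B \<in> sets borel" "bounded (A \<inter> B)"
    using A B by auto
  have "(\<integral>\<^sup>+\<omega>. (\<Sum>i. indicator A (X i \<omega>)) * (\<Sum>j. indicator B (X j \<omega>)) \<partial>M) =
      ?off + (\<Sum>i. \<integral>\<^sup>+\<omega>. indicator A (X i \<omega>) * indicator B (X i \<omega>) \<partial>M)"
    by (rule nn_integral_suminf_mult_suminf) measurable
  also have "(\<Sum>i. \<integral>\<^sup>+\<omega>. indicator A (X i \<omega>) * indicator B (X i \<omega>) \<partial>M) = ?diag"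
    using intensity_bounded[OF AB] ennreal_mean_count[OF AB(2)]
    by (simp add: indicator_inter_arith)
  also have "(\<integral>\<^sup>+\<omega>. (\<Sum>i. indicator A (X i \<omega>)) * (\<Sum>j. indicator B (X j \<omega>)) \<partial>M) =
      (\<integral>\<^sup>+\<omega>. ennreal (real (count A \<omega>)) * ennreal (real (count B \<omega>)) \<partial>M)"
  proof (rule nn_integral_cong_AE)
    show "AE \<omega> in M. (\<Sum>i. indicator A (X i \<omega>)) * (\<Sum>j. indicator B (X j \<omega>)) =
        ennreal (real (count A \<omega>)) * ennreal (real (count B \<omega>))"
      using AE_suminf_indicator[OF A] AE_suminf_indicator[OF B] by eventually_elim simp
  qed
  also have "\<dots> = ennreal (dens * measure lborel A) * ennreal (dens * measure lborel B) + ?diag"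
    by (rule nn_integral_count_mult[OF A B])
  finally have "?diag + ennreal (dens * measure lborel A) * ennreal (dens * measure lborel B) =
      ?diag + ?off"
    by (simp only: add.commute)
  then show ?thesis
    by (simp add: ennreal_add_left_cancel ennreal_mean_count A B)
qed

text \<open>Both sides integrate \<open>f\<close>, against the intensity measure and against a
  multiple of Lebesgue measure. These agree on bounded Borel sets, which are stable under
  intersection, generate the Borel sets, and contain balls of finite mass that exhaust the
  plane.\<close>

lemma campbell:
  assumes [measurable]: "f \<in> borel_measurable borel"
  shows "(\<Sum>i. \<integral>\<^sup>+\<omega>. f (X i \<omega>) \<partial>M) = ennreal dens * (\<integral>\<^sup>+x. f x \<partial>lborel)"
proof -
  \<comment> \<open>The intensity measure: summing over indices and taking expectations is one
    integral over a product.\<close>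
  define \<nu> where "\<nu> = distr (count_space UNIV \<Otimes>\<^sub>M M) borel (\<lambda>(i, \<omega>). X i \<omega>)"
  have [measurable]: "(\<lambda>(i, \<omega>). X i \<omega>) \<in> count_space UNIV \<Otimes>\<^sub>M M \<rightarrow>\<^sub>M borel"
    by (rule measurable_pair_measure_countable1) auto
  have \<nu>: "(\<integral>\<^sup>+x. h x \<partial>\<nu>) = (\<Sum>i. \<integral>\<^sup>+\<omega>. h (X i \<omega>) \<partial>M)"
    if [measurable]: "h \<in> borel_measurable borel" for h
    unfolding \<nu>_def
    by (simp add: nn_integral_distr nn_integral_fst[symmetric] nn_integral_count_space_nat)
  have sets_\<nu>: "sets \<nu> = sets borel"
    by (simp add: \<nu>_def)
  have bounded_eq: "emeasure \<nu> B = ennreal dens * emeasure lborel B"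
    if "B \<in> sets borel" "bounded B" for B
    using \<nu>[of "indicator B"] intensity_bounded[OF that] that sets_\<nu> by simp
  have "\<nu> = density lborel (\<lambda>_. ennreal dens)"
  proof (rule measure_eqI_generator_eq)
    let ?E = "{B :: (real^2) set. B \<in> sets borel \<and> bounded B}"
    show "Int_stable ?E"
      by (auto simp: Int_stable_def)
    show "?E \<subseteq> Pow UNIV"
      by simp
    show "emeasure \<nu> B = emeasure (density lborel (\<lambda>_. ennreal dens)) B" if "B \<in> ?E" for B
      using that by (simp add: bounded_eq emeasure_density_const)
    have borel: "sets (borel :: (real^2) measure) = sigma_sets UNIV ?E"
    proof
      have "sigma_sets UNIV (range (\<lambda>(a, b). box a b :: (real^2) set)) \<subseteq> sigma_sets UNIV ?E"
        by (rule sigma_sets_subseteq) auto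
      then show "sets (borel :: (real^2) measure) \<subseteq> sigma_sets UNIV ?E"
        by (simp add: borel_eq_box)
      show "sigma_sets UNIV ?E \<subseteq> sets (borel :: (real^2) measure)"
        using sets.sigma_sets_subset[of ?E borel] by auto
    qed
    then show "sets \<nu> = sigma_sets UNIV ?E"
      "sets (density lborel (\<lambda>_. ennreal dens)) = sigma_sets UNIV ?E"
      by (simp_all add: sets_\<nu>)
    show "range (\<lambda>n. cball 0 (real n)) \<subseteq> ?E"
      by auto
    show "(\<Union>n. cball 0 (real n)) = (UNIV :: (real^2) set)"
      by (simp add: set_eq_iff real_arch_simple)
    show "emeasure \<nu> (cball 0 (real n)) \<noteq> \<infinity>" for n
      using emeasure_bounded_finite[of "cball (0 :: real^2) (real n)"]
      by (simp add: bounded_eq ennreal_mult_eq_top_iff)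
  qed
  with \<nu>[of f] show ?thesis
    by (simp add: nn_integral_density nn_integral_cmult)
qed

text \<open>The second factorial moment measure, formed from pairs of distinct indices, is the
  product of the intensity with itself. It suffices to compare the two on rectangles.\<close>

lemma campbell_off_diagonal:
  assumes [measurable]: "f \<in> borel_measurable borel" "g \<in> borel_measurable borel"
  shows "(\<integral>\<^sup>+(i, j). (\<integral>\<^sup>+\<omega>. f (X i \<omega>) * g (X j \<omega>) \<partial>M) \<partial>count_space {(i, j). i \<noteq> j}) =
    (ennreal dens * (\<integral>\<^sup>+x. f x \<partial>lborel)) * (ennreal dens * (\<integral>\<^sup>+x. g x \<partial>lborel))"
proof -
  define D :: "(nat \<times> nat) set" where "D = {(i, j). i \<noteq> j}"
  let ?L = "density lborel (\<lambda>_. ennreal dens) :: (real^2) measure"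
  define \<nu> where "\<nu> = distr (count_space D \<Otimes>\<^sub>M M) (borel \<Otimes>\<^sub>M borel)
    (\<lambda>z. (X (fst (fst z)) (snd z), X (snd (fst z)) (snd z)))"
  have [measurable]: "(\<lambda>z. (X (fst (fst z)) (snd z), X (snd (fst z)) (snd z))) \<in>
      count_space D \<Otimes>\<^sub>M M \<rightarrow>\<^sub>M borel \<Otimes>\<^sub>M borel"
    by (rule measurable_pair_measure_countable1) auto
  have \<nu>: "(\<integral>\<^sup>+z. h z \<partial>\<nu>) = (\<integral>\<^sup>+(i, j). (\<integral>\<^sup>+\<omega>. h (X i \<omega>, X j \<omega>) \<partial>M) \<partial>count_space D)"
    if [measurable]: "h \<in> borel_measurable (borel \<Otimes>\<^sub>M borel)" for h
    unfolding \<nu>_def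
    by (simp add: nn_integral_distr nn_integral_fst[symmetric] case_prod_unfold)
  have sets_\<nu>: "sets \<nu> = sets (borel \<Otimes>\<^sub>M borel)"
    by (simp add: \<nu>_def)
  have sigma_finite: "sigma_finite_measure ?L"
    by (subst sigma_finite_measure.sigma_finite_iff_density_finite[OF sigma_finite_lborel]) auto
  interpret L: sigma_finite_measure ?L by (rule sigma_finite)
  have bounded_eq: "emeasure \<nu> (A \<times> B) = emeasure (?L \<Otimes>\<^sub>M ?L) (A \<times> B)"
    if A: "A \<in> sets borel" "bounded A" and B: "B \<in> sets borel" "bounded B" for A B
  proof -
    have AB: "A \<times> B \<in> sets (borel \<Otimes>\<^sub>M borel)"
      using A B by auto
    have "emeasure \<nu> (A \<times> B) = (\<integral>\<^sup>+z. indicator (A \<times> B) z \<partial>\<nu>)"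
      using AB by (simp add: sets_\<nu>)
    also have "\<dots> = (\<integral>\<^sup>+(i, j). (\<integral>\<^sup>+\<omega>. indicator A (X i \<omega>) * indicator B (X j \<omega>) \<partial>M) \<partial>count_space D)"
      using AB by (subst \<nu>) (auto simp: indicator_times)
    also have "\<dots> = emeasure (?L \<Otimes>\<^sub>M ?L) (A \<times> B)"
      using A B by (simp add: factorial_moment_bounded L.emeasure_pair_measure_Times emeasure_density_const D_def)
    finally show ?thesis .
  qed
  have "?L \<Otimes>\<^sub>M ?L = \<nu>"
  proof (rule pair_measure_eqI)
    show "sets (?L \<Otimes>\<^sub>M ?L) = sets \<nu>"
      by (simp add: sets_\<nu> cong: sets_pair_measure_cong)
    fix A B assume "A \<in> sets ?L" "B \<in> sets ?L"
    then have AB: "A \<in> sets borel" "B \<in> sets borel"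
      by simp_all
    \<comment> \<open>\<open>pair_measure_eqI\<close> asks for arbitrary Borel rectangles, while
      \<open>bounded_eq\<close> covers bounded ones; continuity from below closes the gap.\<close>
    define S where "S n = (A \<inter> cball 0 (real n)) \<times> (B \<inter> cball 0 (real n))" for n
    have "(\<Union>n. S n) = A \<times> B"
    proof safe
      fix x y assume "x \<in> A" "y \<in> B"
      moreover obtain n where "max (norm x) (norm y) \<le> real n"
        using real_arch_simple by blast
      ultimately have "(x, y) \<in> S n"
        by (simp add: S_def)
      then show "(x, y) \<in> (\<Union>n. S n)"
        by blast
    qed (auto simp: S_def)
    moreover have "incseq S"
      by (auto simp: S_def incseq_def)
    moreover have S: "range S \<subseteq> sets (borel \<Otimes>\<^sub>M borel)"
      using AB by (auto simp: S_def)
    ultimately have SUP: "(SUP n. emeasure N (S n)) = emeasure N (A \<times> B)"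
      if "sets N = sets (borel \<Otimes>\<^sub>M borel)" for N :: "((real^2) \<times> (real^2)) measure"
      using SUP_emeasure_incseq[of S N] that by simp
    have "emeasure \<nu> (S n) = emeasure (?L \<Otimes>\<^sub>M ?L) (S n)" for n
      unfolding S_def using AB by (intro bounded_eq) auto
    then have "emeasure \<nu> (A \<times> B) = emeasure (?L \<Otimes>\<^sub>M ?L) (A \<times> B)"
      using SUP[of \<nu>] SUP[of "?L \<Otimes>\<^sub>M ?L"]
      by (simp add: sets_\<nu> cong: sets_pair_measure_cong)
    then show "emeasure ?L A * emeasure ?L B = emeasure \<nu> (A \<times> B)"
      using AB by (simp add: L.emeasure_pair_measure_Times)
  qed (fact sigma_finite)+
  then have "(\<integral>\<^sup>+z. f (fst z) * g (snd z) \<partial>(?L \<Otimes>\<^sub>M ?L)) =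
      (\<integral>\<^sup>+(i, j). (\<integral>\<^sup>+\<omega>. f (X i \<omega>) * g (X j \<omega>) \<partial>M) \<partial>count_space D)"
    using \<nu>[of "\<lambda>z. f (fst z) * g (snd z)"] by simp
  moreover have "(\<integral>\<^sup>+z. f (fst z) * g (snd z) \<partial>(?L \<Otimes>\<^sub>M ?L)) =
      (\<integral>\<^sup>+x. f x \<partial>?L) * (\<integral>\<^sup>+x. g x \<partial>?L)"
    by (simp add: L.nn_integral_fst[symmetric] nn_integral_cmult nn_integral_multc)
  ultimately show ?thesis
    by (simp add: nn_integral_density nn_integral_cmult D_def)
qed

end

section \<open>Moments of the interference\<close>

sublocale aloha_network \<subseteq> enumerated_poisson_process M dens \<Phi> X
  by unfold_locales (fact dens_pos poisson X_measurable X_enumerates)+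

context aloha_network
begin

text \<open>This and the next two abbreviations name the sigma-algebras that
  \<open>X_T_h_indep\<close> declares independent.\<close>

abbreviation node_algebra :: "'w measure" where
  "node_algebra \<equiv> vimage_algebra (space M) (\<lambda>\<omega> i. X i \<omega>) (PiM UNIV (\<lambda>_. borel))"

abbreviation aloha_algebra :: "'w measure" where
  "aloha_algebra \<equiv>
    vimage_algebra (space M) (\<lambda>\<omega> (i, k). T i k \<omega>) (PiM UNIV (\<lambda>_. count_space UNIV))"

abbreviation fading_algebra :: "'w measure" where
  "fading_algebra \<equiv> vimage_algebra (space M) (\<lambda>\<omega> (i, z, k). h i z k \<omega>) (PiM UNIV (\<lambda>_. borel))"

lemma measurable_X_node_algebra: "X i \<in> node_algebra \<rightarrow>\<^sub>M borel"
proof -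
  have "(\<lambda>\<omega> i. X i \<omega>) \<in> node_algebra \<rightarrow>\<^sub>M PiM UNIV (\<lambda>_. borel)"
    by (rule measurable_vimage_algebra1) (auto simp: space_PiM)
  from measurable_component_singleton[THEN measurable_compose[OF this], of i]
  show ?thesis by simp
qed

lemma measurable_T_aloha_algebra: "T i k \<in> aloha_algebra \<rightarrow>\<^sub>M count_space UNIV"
proof -
  have "(\<lambda>\<omega> (i, k). T i k \<omega>) \<in> aloha_algebra \<rightarrow>\<^sub>M PiM UNIV (\<lambda>_. count_space UNIV)"
    by (rule measurable_vimage_algebra1) (auto simp: space_PiM)
  from measurable_component_singleton[THEN measurable_compose[OF this], of "(i, k)"]
  show ?thesis by simp
qed

lemma measurable_h_fading_algebra: "h i z k \<in> fading_algebra \<rightarrow>\<^sub>M borel"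
proof -
  have "(\<lambda>\<omega> (i, z, k). h i z k \<omega>) \<in> fading_algebra \<rightarrow>\<^sub>M PiM UNIV (\<lambda>_. borel)"
    by (rule measurable_vimage_algebra1) (auto simp: space_PiM)
  from measurable_component_singleton[THEN measurable_compose[OF this], of "(i, z, k)"]
  show ?thesis by simp
qed

lemma measurable_T [measurable]: "T i k \<in> M \<rightarrow>\<^sub>M count_space UNIV"
  using T_indep unfolding indep_vars_def by fastforce

lemma measurable_h [measurable]: "h i z k \<in> borel_measurable M"
  using h_indep unfolding indep_vars_def by fastforce

text \<open>Each factor may depend on several nodes, slots and locations at once; being measurable
  for its own sigma-algebra makes it independent of the other two.\<close>

lemma nn_integral_node_aloha_fading:
  assumes f: "f \<in> borel_measurable node_algebra"
    and t: "t \<in> borel_measurable aloha_algebra"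
    and r: "r \<in> borel_measurable fading_algebra"
  shows "(\<integral>\<^sup>+\<omega>. t \<omega> * r \<omega> * f \<omega> \<partial>M) =
    (\<integral>\<^sup>+\<omega>. t \<omega> \<partial>M) * (\<integral>\<^sup>+\<omega>. r \<omega> \<partial>M) * (\<integral>\<^sup>+\<omega>. f \<omega> \<partial>M)"
proof -
  let ?F = "(!) [sets node_algebra, sets aloha_algebra, sets fading_algebra]"
  define Y where "Y = (!) [f, t, r]"
  have sub: "{Y n -` A \<inter> space M | A. A \<in> sets borel} \<subseteq> ?F n" if "n \<in> {..<3}" for n
  proof -
    from that consider "n = 0" | "n = 1" | "n = 2"
      by (auto simp: less_Suc_eq numeral_3_eq_3)
    then show ?thesis
      using measurable_sets[OF f] measurable_sets[OF t] measurable_sets[OF r]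
      by cases (auto simp: Y_def)
  qed
  have indep: "indep_sets (\<lambda>n. {Y n -` A \<inter> space M | A. A \<in> sets borel}) {..<3}"
    by (rule indep_sets_mono_sets[OF X_T_h_indep sub])
  \<comment> \<open>Measurability for \<open>M\<close> is read off from \<open>indep_sets\<close>,
    which requires its members to be events.\<close>
  have "Y n \<in> borel_measurable M" if "n \<in> {..<3}" for n
  proof (rule measurableI)
    fix A :: "ennreal set" assume "A \<in> sets borel"
    then show "Y n -` A \<inter> space M \<in> events"
      using indep that unfolding indep_sets_def by blast
  qed simp
  with indep have "indep_vars (\<lambda>_. borel) Y {..<3}"
    unfolding indep_vars_def2 by simp
  then have "(\<integral>\<^sup>+\<omega>. (\<Prod>n<3. Y n \<omega>) \<partial>M) = (\<Prod>n<3. \<integral>\<^sup>+\<omega>. Y n \<omega> \<partial>M)"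
    by (intro indep_vars_nn_integral) auto
  then show ?thesis
    by (simp add: Y_def numeral_3_eq_3 ac_simps)
qed

section \<open>Moments of the ALOHA decisions and of the fading\<close>

lemma nn_integral_T: "(\<integral>\<^sup>+\<omega>. of_bool (T i k \<omega>) \<partial>M) = ennreal p"
proof -
  have "(\<integral>\<^sup>+\<omega>. of_bool (T i k \<omega>) \<partial>M) = (\<integral>\<^sup>+b. of_bool b \<partial>distr M (count_space UNIV) (T i k))"
    by (simp add: nn_integral_distr)
  then show ?thesis
    using p_range by (simp add: T_distr)
qed

text \<open>Serves two purposes: distinct nodes in any slots, and one node in two distinct
  slots.\<close>

lemma nn_integral_T_mult:
  assumes "(i, k) \<noteq> (j, l)"
  shows "(\<integral>\<^sup>+\<omega>. of_bool (T i k \<omega>) * of_bool (T j l \<omega>) \<partial>M) = (ennreal p)\<^sup>2"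
proof -
  let ?t = "\<lambda>q \<omega>. of_bool ((case q of (i, k) \<Rightarrow> T i k) \<omega>) :: ennreal"
  have "indep_vars (\<lambda>_. borel) ?t UNIV"
    by (rule indep_vars_compose2[OF T_indep]) simp
  then have "indep_vars (\<lambda>_. borel) ?t {(i, k), (j, l)}"
    by (rule indep_vars_subset) simp
  then have "(\<integral>\<^sup>+\<omega>. (\<Prod>q\<in>{(i, k), (j, l)}. ?t q \<omega>) \<partial>M) =
      (\<Prod>q\<in>{(i, k), (j, l)}. \<integral>\<^sup>+\<omega>. ?t q \<omega> \<partial>M)"
    by (intro indep_vars_nn_integral) auto
  then show ?thesis
    using assms by (simp add: nn_integral_T power2_eq_square)
qed

lemma nn_integral_fading:
  assumes "f \<in> borel_measurable borel"
  shows "(\<integral>\<^sup>+\<omega>. f (h i z k \<omega>) \<partial>M) = (\<integral>\<^sup>+t. f t \<partial>H)"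
  using assms by (simp add: nn_integral_distr flip: h_distr[of i z k])

lemma nn_integral_h: "(\<integral>\<^sup>+\<omega>. ennreal (h i z k \<omega>) \<partial>M) = 1"
proof -
  have "(\<integral>\<^sup>+\<omega>. ennreal (h i z k \<omega>) \<partial>M) = (\<integral>\<^sup>+t. ennreal t \<partial>H)"
    by (rule nn_integral_fading) simp
  also have "\<dots> = 1"
    using nn_integral_eq_integral[OF H_mean(1) H_nonneg] H_mean(2) by simp
  finally show ?thesis .
qed

lemma nn_integral_h_square:
  "(\<integral>\<^sup>+\<omega>. ennreal (h i z k \<omega>) * ennreal (h i z k \<omega>) \<partial>M) = (\<integral>\<^sup>+t. ennreal (t\<^sup>2) \<partial>H)"
proof -
  have "(\<integral>\<^sup>+\<omega>. ennreal (h i z k \<omega>) * ennreal (h i z k \<omega>) \<partial>M) = (\<integral>\<^sup>+t. ennreal t * ennreal t \<partial>H)"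
    by (rule nn_integral_fading) simp
  also have "\<dots> = (\<integral>\<^sup>+t. ennreal (t\<^sup>2) \<partial>H)"
    \<comment> \<open>\<open>ennreal\<close> sends negative reals to 0, so the two integrands agree
      only where \<open>t\<close> is nonnegative.\<close>
    using H_nonneg
    by (intro nn_integral_cong_AE) (auto simp: power2_eq_square ennreal_mult elim!: eventually_mono)
  finally show ?thesis .
qed

lemma nn_integral_h_mult:
  assumes "(i, z, k) \<noteq> (j, z', l)"
  shows "(\<integral>\<^sup>+\<omega>. ennreal (h i z k \<omega>) * ennreal (h j z' l \<omega>) \<partial>M) = 1"
proof -
  let ?r = "\<lambda>q \<omega>. ennreal ((case q of (i, z, k) \<Rightarrow> h i z k) \<omega>)"
  have "indep_vars (\<lambda>_. borel) ?r UNIV"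
    by (rule indep_vars_compose2[OF h_indep]) simp
  then have "indep_vars (\<lambda>_. borel) ?r {(i, z, k), (j, z', l)}"
    by (rule indep_vars_subset) simp
  then have "(\<integral>\<^sup>+\<omega>. (\<Prod>q\<in>{(i, z, k), (j, z', l)}. ?r q \<omega>) \<partial>M) =
      (\<Prod>q\<in>{(i, z, k), (j, z', l)}. \<integral>\<^sup>+\<omega>. ?r q \<omega> \<partial>M)"
    by (intro indep_vars_nn_integral) auto
  then show ?thesis
    using assms by (simp add: nn_integral_h)
qed

lemma nn_integral_interference:
  assumes [measurable]: "g \<in> borel_measurable borel"
  shows "(\<integral>\<^sup>+\<omega>. interference X T h g k z \<omega> \<partial>M) =
    ennreal p * (ennreal dens * (\<integral>\<^sup>+x. g x \<partial>lborel))"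
proof -
  note [measurable] = measurable_X_node_algebra measurable_T_aloha_algebra measurable_h_fading_algebra
  have "(\<integral>\<^sup>+\<omega>. interference X T h g k z \<omega> \<partial>M) =
      (\<Sum>i. \<integral>\<^sup>+\<omega>. of_bool (T i k \<omega>) * ennreal (h i z k \<omega>) * g (X i \<omega> - z) \<partial>M)"
    unfolding interference_def by (rule nn_integral_suminf) measurable
  also have "\<dots> = (\<Sum>i. ennreal p * (\<integral>\<^sup>+\<omega>. g (X i \<omega> - z) \<partial>M))"
    by (subst nn_integral_node_aloha_fading) (simp_all add: nn_integral_T nn_integral_h)
  also have "\<dots> = ennreal p * (ennreal dens * (\<integral>\<^sup>+x. g (x - z) \<partial>lborel))"
    by (simp add: campbell[of "\<lambda>x. g (x - z)"])
  finally show ?thesis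
    by (simp add: nn_integral_lborel_translation)
qed

text \<open>Covers covariance and variance together. Distinct nodes have independent marks whatever
  the slots and locations, so the off-diagonal part is always the squared mean. The cases differ
  only in the diagonal weight \<open>c\<close>.\<close>

lemma nn_integral_interference_mult:
  assumes [measurable]: "g \<in> borel_measurable borel"
    and c: "\<And>i. (\<integral>\<^sup>+\<omega>. of_bool (T i k \<omega>) * of_bool (T i l \<omega>) \<partial>M) *
      (\<integral>\<^sup>+\<omega>. ennreal (h i u k \<omega>) * ennreal (h i v l \<omega>) \<partial>M) = c"
  shows "(\<integral>\<^sup>+\<omega>. interference X T h g k u \<omega> * interference X T h g l v \<omega> \<partial>M) =
    (ennreal p * (ennreal dens * (\<integral>\<^sup>+x. g x \<partial>lborel)))\<^sup>2 +
    c * (ennreal dens * (\<integral>\<^sup>+x. g (x - u) * g (x - v) \<partial>lborel))"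
proof -
  note [measurable] = measurable_X_node_algebra measurable_T_aloha_algebra measurable_h_fading_algebra
  let ?I = "\<lambda>k z i \<omega>. of_bool (T i k \<omega>) * ennreal (h i z k \<omega>) * g (X i \<omega> - z)"
  let ?A = "ennreal dens * (\<integral>\<^sup>+x. g x \<partial>lborel)"
  have factor: "(\<integral>\<^sup>+\<omega>. ?I k u i \<omega> * ?I l v j \<omega> \<partial>M) =
      (\<integral>\<^sup>+\<omega>. of_bool (T i k \<omega>) * of_bool (T j l \<omega>) \<partial>M) *
      (\<integral>\<^sup>+\<omega>. ennreal (h i u k \<omega>) * ennreal (h j v l \<omega>) \<partial>M) *
      (\<integral>\<^sup>+\<omega>. g (X i \<omega> - u) * g (X j \<omega> - v) \<partial>M)" for i j
    by (subst nn_integral_node_aloha_fading[symmetric]) (simp_all add: ac_simps)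
  have "(\<integral>\<^sup>+\<omega>. interference X T h g k u \<omega> * interference X T h g l v \<omega> \<partial>M) =
      (\<integral>\<^sup>+(i, j). (\<integral>\<^sup>+\<omega>. ?I k u i \<omega> * ?I l v j \<omega> \<partial>M) \<partial>count_space {(i, j). i \<noteq> j}) +
      (\<Sum>i. \<integral>\<^sup>+\<omega>. ?I k u i \<omega> * ?I l v i \<omega> \<partial>M)"
    unfolding interference_def by (rule nn_integral_suminf_mult_suminf) measurable
  also have "(\<integral>\<^sup>+(i, j). (\<integral>\<^sup>+\<omega>. ?I k u i \<omega> * ?I l v j \<omega> \<partial>M) \<partial>count_space {(i, j). i \<noteq> j}) =
      (\<integral>\<^sup>+q. (ennreal p)\<^sup>2 * (case q of (i, j) \<Rightarrow> \<integral>\<^sup>+\<omega>. g (X i \<omega> - u) * g (X j \<omega> - v) \<partial>M)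
        \<partial>count_space {(i, j). i \<noteq> j})"
    by (intro nn_integral_cong) (auto simp: factor nn_integral_T_mult nn_integral_h_mult)
  also have "\<dots> = (ennreal p)\<^sup>2 * (?A * ?A)"
    by (simp add: nn_integral_cmult campbell_off_diagonal[of "\<lambda>x. g (x - u)" "\<lambda>x. g (x - v)"]
        nn_integral_lborel_translation)
  also have "(\<Sum>i. \<integral>\<^sup>+\<omega>. ?I k u i \<omega> * ?I l v i \<omega> \<partial>M) =
      c * (\<Sum>i. \<integral>\<^sup>+\<omega>. g (X i \<omega> - u) * g (X i \<omega> - v) \<partial>M)"
    by (simp only: factor c ennreal_suminf_cmult)
  also have "\<dots> = c * (ennreal dens * (\<integral>\<^sup>+x. g (x - u) * g (x - v) \<partial>lborel))"
    by (simp add: campbell[of "\<lambda>x. g (x - u) * g (x - v)"])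
  finally show ?thesis
    by (simp add: power2_eq_square ac_simps)
qed

end

section \<open>Extended real arithmetic and the correlation coefficient\<close>

lemma enn2ereal_power2: "enn2ereal (x\<^sup>2) = (enn2ereal x)\<^sup>2"
  by (simp add: power2_eq_square times_ennreal.rep_eq)

text \<open>Finiteness of \<open>x\<close> excludes \<infinity> - \<infinity>; \<open>y\<close> may
  be infinite, as it is when the variance is.\<close>

lemma enn2ereal_add_minus_cancel:
  assumes "x \<noteq> \<infinity>"
  shows "enn2ereal (x + y) - enn2ereal x = enn2ereal y"
proof -
  have "\<bar>enn2ereal x\<bar> \<noteq> \<infinity>"
    using assms by (cases x) auto
  then show ?thesis
    by (cases "enn2ereal x"; cases "enn2ereal y") (auto simp: plus_ennreal.rep_eq)
qed

text \<open>Degenerate denominators are included: for \<open>y = \<infinity>\<close> both quotients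
  are 0, and for \<open>y = 0\<close> both are 0 or \<infinity> according to whether
  \<open>x\<close> vanishes.\<close>

lemma ereal_mult_divide_mult_cancel_nonneg:
  fixes x y :: ereal
  assumes "0 < c" "0 \<le> x" "0 \<le> y"
  shows "(ereal c * x) / (ereal c * y) = x / y"
  using assms by (cases x; cases y) (auto simp: zero_ereal_def divide_ereal_def)

theorem lemma1:
  fixes M :: "'w measure"
    and dens p :: real
    and H :: "real measure"
    and \<Phi> :: "'w \<Rightarrow> (real^2) set"
    and X :: "nat \<Rightarrow> 'w \<Rightarrow> real^2"
    and T :: "nat \<Rightarrow> nat \<Rightarrow> 'w \<Rightarrow> bool"
    and h :: "nat \<Rightarrow> real^2 \<Rightarrow> nat \<Rightarrow> 'w \<Rightarrow> real"
    and g :: "real^2 \<Rightarrow> ennreal"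
    and G :: "real \<Rightarrow> ennreal"
    and k l :: nat
    and u v w :: "real^2"
  assumes network: "aloha_network M dens p H \<Phi> X T h"
    and radial: "\<And>x. g x = G (norm x)"
    and decreasing: "\<And>r s. 0 \<le> r \<Longrightarrow> r \<le> s \<Longrightarrow> G s \<le> G r"
    and integrable: "(\<integral>\<^sup>+r\<in>{0..}. ennreal r * G r \<partial>lborel) < \<infinity>"
    and "k \<noteq> l"
    and "norm w = norm (u - v)"
  shows "correlation_coefficient M (interference X T h g k u) (interference X T h g l v) =
           (ereal p * enn2ereal (\<integral>\<^sup>+x. g x * g (x - w) \<partial>lborel)) /
           (expect H (\<lambda>t. ennreal (t\<^sup>2)) * enn2ereal (\<integral>\<^sup>+x. (g x)\<^sup>2 \<partial>lborel))"
proof -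
  interpret aloha_network M dens p H \<Phi> X T h by (rule network)
  have g [measurable]: "g \<in> borel_measurable borel"
    using radial decreasing by (rule borel_measurable_radial_decreasing)
  define E where "E = (\<integral>\<^sup>+t. ennreal (t\<^sup>2) \<partial>H)"
  define C where "C = (\<integral>\<^sup>+x. g x * g (x - w) \<partial>lborel)"
  define B where "B = (\<integral>\<^sup>+x. (g x)\<^sup>2 \<partial>lborel)"
  define m where "m = ennreal p * (ennreal dens * (\<integral>\<^sup>+x. g x \<partial>lborel))"
  have mean: "expect M (interference X T h g k u) = enn2ereal m"
    by (simp add: expect_def nn_integral_interference m_def)
  have "(\<integral>\<^sup>+x. g x \<partial>lborel) < \<infinity>"
    using integrable by (simp add: nn_integral_radial_decreasing[of g G, OF radial decreasing] ennreal_mult_less_top)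
  then have m_finite: "m\<^sup>2 \<noteq> \<infinity>"
    by (simp add: m_def ennreal_mult_eq_top_iff power2_eq_square)
  have "(\<integral>\<^sup>+x. g (x - u) * g (x - v) \<partial>lborel) = C"
    unfolding C_def by (rule nn_integral_radial_convolution_cong) (fact | simp add: radial)+
  then have mixed: "expect M (\<lambda>\<omega>. interference X T h g k u \<omega> * interference X T h g l v \<omega>) =
      enn2ereal (m\<^sup>2 + (ennreal p)\<^sup>2 * (ennreal dens * C))"
    using \<open>k \<noteq> l\<close>
    by (simp add: expect_def m_def nn_integral_T_mult nn_integral_h_mult
        nn_integral_interference_mult[where c = "(ennreal p)\<^sup>2"])
  have "(\<integral>\<^sup>+x. g (x - u) * g (x - u) \<partial>lborel) = B"
    using nn_integral_lborel_translation[of "\<lambda>x. g x * g x" u]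
    by (simp add: B_def power2_eq_square)
  \<comment> \<open>Within one slot the squared indicator is the indicator itself, so the diagonal
    weight has the factor \<open>p\<close> instead of \<open>p\<^sup>2\<close>.\<close>
  moreover have "(of_bool b * of_bool b :: ennreal) = of_bool b" for b
    by simp
  ultimately have square: "expect M (\<lambda>\<omega>. (interference X T h g k u \<omega>)\<^sup>2) =
      enn2ereal (m\<^sup>2 + ennreal p * E * (ennreal dens * B))"
    unfolding power2_eq_square[of "interference X T h g k u _"]
    by (simp only: expect_def m_def nn_integral_T nn_integral_h_square E_def
        nn_integral_interference_mult[where c = "ennreal p * (\<integral>\<^sup>+t. ennreal (t\<^sup>2) \<partial>H)"] g)
  have "correlation_coefficient M (interference X T h g k u) (interference X T h g l v) =
      enn2ereal ((ennreal p)\<^sup>2 * (ennreal dens * C)) / enn2ereal (ennreal p * E * (ennreal dens * B))"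
    unfolding correlation_coefficient_def mean mixed square enn2ereal_power2[symmetric]
    by (simp only: enn2ereal_add_minus_cancel[OF m_finite])
  also have "\<dots> = (ereal p * enn2ereal C) / (enn2ereal E * enn2ereal B)"
  \<comment> \<open>For positive \<open>p\<close> the common factor \<open>p * dens\<close> cancels,
    leaving one \<open>p\<close> in the numerator. For \<open>p = 0\<close> both numerators vanish,
    and 0 divided by anything, even by 0, is 0 in \<open>ereal\<close>.\<close>
  proof (cases "p = 0")
    case False
    then have "0 < p * dens"
      using p_range dens_pos by simp
    moreover have "enn2ereal ((ennreal p)\<^sup>2 * (ennreal dens * C)) = ereal (p * dens) * (ereal p * enn2ereal C)"
      using p_range dens_pos
      by (simp add: power2_eq_square times_ennreal.rep_eq enn2ereal_ennreal ac_simps flip: times_ereal.simps(1))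
    moreover have "enn2ereal (ennreal p * E * (ennreal dens * B)) = ereal (p * dens) * (enn2ereal E * enn2ereal B)"
      using p_range dens_pos
      by (simp add: times_ennreal.rep_eq enn2ereal_ennreal ac_simps flip: times_ereal.simps(1))
    ultimately show ?thesis
      using p_range by (simp only: ereal_mult_divide_mult_cancel_nonneg ereal_0_le_mult enn2ereal_nonneg ereal_less_eq)
  qed (simp add: zero_ennreal.rep_eq flip: zero_ereal_def)
  finally show ?thesis
    by (simp add: C_def E_def B_def expect_def)
qed

end
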